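(* Let $P$ be a training set in a metric space $(\mathcal{X},\mathsf{d})$ and let $\varepsilon>0$. Then every $\frac{2}{\varepsilon}$-selective subset $R\subseteq P$ is an $\varepsilon$-coreset for the nearest-neighbor rule on $P$.
   Context: A training set is a finite set $P$ of distinct points of a metric space $(\mathcal{X},\mathsf{d})$, each $p\in P$ carrying a label (class) $l(p)$; at least two classes occur. For $p\in P$, $\mathsf{d}_{\mathrm{ne}}(p,P)$ denotes the distance from $p$ to the closest point of $P$ whose label differs from $l(p)$. For $q\in\mathcal{X}$ and nonempty $R\subseteq P$, $\mathsf{d}_{\mathrm{nn}}(q,R)=\min_{r\in R}\mathsf{d}(q,r)$. For $\alpha\ge 0$, a nonempty subset $R\subseteq P$ is $\alpha$-selective if $\mathsf{d}_{\mathrm{nn}}(p,R)<\mathsf{d}_{\mathrm{ne}}(p,P)/(1+\alpha)$ for all $p\in P$. An $\varepsilon$-approximate nearest-neighbor of $q$ in $P$ is any $p\in P$ with $\mathsf{d}(q,p)\le(1+\varepsilon)\,\mathsf{d}_{\mathrm{nn}}(q,P)$. A subset $R\subseteq P$ is an $\varepsilon$-coreset for the nearest-neighbor rule on $P$ if for every query point $q\in\mathcal{X}$, the class of the exact nearest-neighbor of $q$ in $R$ (ties broken arbitrarily) equals the class of some $\varepsilon$-approximate nearest-neighbor of $q$ in $P$. *)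

theory Defs
  imports "HOL-Analysis.Abstract_Metric_Spaces"
begin

definition training_set ::
    "'a set \<Rightarrow> ('a \<Rightarrow> 'c) \<Rightarrow> 'a set \<Rightarrow> bool" where
  "training_set X l P \<longleftrightarrow>
     finite P \<and> P \<subseteq> X \<and> (\<exists>p\<in>P. \<exists>p'\<in>P. l p \<noteq> l p')"

text \<open>\<^const>\<open>Min\<close> is unspecified on empty sets. In a training set there are at least two classes, so
  every point has some point of another class, and selective subsets and coresets are nonempty by
  definition; hence all minima below are over finite nonempty sets.\<close>

definition dist_nn :: "('a \<Rightarrow> 'a \<Rightarrow> real) \<Rightarrow> 'a \<Rightarrow> 'a set \<Rightarrow> real" where
  "dist_nn d q R = Min ((\<lambda>r. d q r) ` R)"

definition dist_ne ::
    "('a \<Rightarrow> 'a \<Rightarrow> real) \<Rightarrow> ('a \<Rightarrow> 'c) \<Rightarrow> 'a \<Rightarrow> 'a set \<Rightarrow> real" where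
  "dist_ne d l p P = Min ((\<lambda>p'. d p p') ` {p' \<in> P. l p' \<noteq> l p})"

definition selective ::
    "('a \<Rightarrow> 'a \<Rightarrow> real) \<Rightarrow> ('a \<Rightarrow> 'c) \<Rightarrow> 'a set \<Rightarrow> real \<Rightarrow> 'a set \<Rightarrow> bool" where
  "selective d l P \<alpha> R \<longleftrightarrow>
     R \<noteq> {} \<and> R \<subseteq> P \<and> (\<forall>p\<in>P. dist_nn d p R < dist_ne d l p P / (1 + \<alpha>))"

definition nearest_neighbor ::
    "('a \<Rightarrow> 'a \<Rightarrow> real) \<Rightarrow> 'a set \<Rightarrow> 'a \<Rightarrow> 'a \<Rightarrow> bool" where
  "nearest_neighbor d R q r \<longleftrightarrow> r \<in> R \<and> d q r = dist_nn d q R"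

definition approx_nearest_neighbor ::
    "('a \<Rightarrow> 'a \<Rightarrow> real) \<Rightarrow> real \<Rightarrow> 'a set \<Rightarrow> 'a \<Rightarrow> 'a \<Rightarrow> bool" where
  "approx_nearest_neighbor d \<epsilon> P q p \<longleftrightarrow> p \<in> P \<and> d q p \<le> (1 + \<epsilon>) * dist_nn d q P"

text \<open>Ties may be broken arbitrarily, so the condition is required of every exact nearest neighbor
  of \<open>q\<close> in \<open>R\<close>. Nonemptiness of \<open>R\<close> guarantees that there is one.\<close>

definition nn_coreset ::
    "'a set \<Rightarrow> ('a \<Rightarrow> 'a \<Rightarrow> real) \<Rightarrow> ('a \<Rightarrow> 'c) \<Rightarrow> 'a set \<Rightarrow> real \<Rightarrow> 'a set \<Rightarrow> bool" where
  "nn_coreset X d l P \<epsilon> R \<longleftrightarrow>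
     R \<noteq> {} \<and> R \<subseteq> P \<and>
     (\<forall>q\<in>X. \<forall>r. nearest_neighbor d R q r \<longrightarrow>
        (\<exists>p. approx_nearest_neighbor d \<epsilon> P q p \<and> l p = l r))"

end

theory Submission
  imports Defs
begin

text \<open>Let \<open>p\<close> be a nearest neighbor of \<open>q\<close> in \<open>P\<close>, \<open>D = d q p\<close>, and let \<open>t\<close> be the distance from \<open>p\<close>
  to \<open>R\<close>. The nearest neighbor \<open>r\<close> of \<open>q\<close> in \<open>R\<close> satisfies \<open>d q r \<le> D + t\<close>. If \<open>r\<close> and \<open>p\<close> have
  different classes, then selectivity gives \<open>(1 + 2/\<epsilon>) t < d p r \<le> 2 D + t\<close>, so \<open>t < \<epsilon> D\<close> and \<open>r\<close>
  is itself an \<open>\<epsilon>\<close>-approximate nearest neighbor.\<close>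

lemma dist_nn_le:
  assumes "finite R" and "r \<in> R"
  shows "dist_nn d q R \<le> d q r"
  using assms by (simp add: dist_nn_def)

lemma nearest_neighbor_exists:
  assumes "finite R" and "R \<noteq> {}"
  obtains r where "nearest_neighbor d R q r"
proof -
  have "dist_nn d q R \<in> (\<lambda>r. d q r) ` R"
    unfolding dist_nn_def using assms by (intro Min_in) auto
  then obtain r where "r \<in> R" "d q r = dist_nn d q R" by auto
  then show thesis by (intro that) (simp add: nearest_neighbor_def)
qed

lemma dist_ne_le:
  assumes "finite P" and "p' \<in> P" and "l p' \<noteq> l p"
  shows "dist_ne d l p P \<le> d p p'"
  unfolding dist_ne_def using assms by (intro Min_le) auto

theorem theorem4:
  fixes X :: "'a set" and d :: "'a \<Rightarrow> 'a \<Rightarrow> real"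
    and l :: "'a \<Rightarrow> 'c" and P R :: "'a set" and \<epsilon> :: real
  assumes "Metric_space X d"
    and "training_set X l P"
    and "\<epsilon> > 0"
    and "selective d l P (2 / \<epsilon>) R"
  shows "nn_coreset X d l P \<epsilon> R"
proof -
  interpret Metric_space X d by fact
  have P: "finite P" "P \<subseteq> X" "P \<noteq> {}"
    using assms(2) by (auto simp: training_set_def)
  have R: "R \<noteq> {}" "R \<subseteq> P"
    and sel: "\<And>p. p \<in> P \<Longrightarrow> dist_nn d p R < dist_ne d l p P / (1 + 2 / \<epsilon>)"
    using assms(4) by (auto simp: selective_def)
  have finR: "finite R" using P R finite_subset by blast
  have "\<exists>p. approx_nearest_neighbor d \<epsilon> P q p \<and> l p = l r"
    if q: "q \<in> X" and nn: "nearest_neighbor d R q r" for q r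
  proof -
    obtain p where "nearest_neighbor d P q p"
      using nearest_neighbor_exists P by metis
    then have p: "p \<in> P" and D: "d q p = dist_nn d q P"
      by (auto simp: nearest_neighbor_def)
    \<comment> \<open>\<open>s\<close> realises the distance from \<open>p\<close> to
      \<open>R\<close>, so selectivity bounds \<open>d p s\<close>, and as a point of
      \<open>R\<close> it is no closer to \<open>q\<close> than \<open>r\<close>.\<close>
    obtain s where "nearest_neighbor d R p s"
      using nearest_neighbor_exists finR R by metis
    then have s: "s \<in> R" and t: "d p s = dist_nn d p R"
      by (auto simp: nearest_neighbor_def)
    have r: "r \<in> R" using nn by (simp add: nearest_neighbor_def)
    have inX: "p \<in> X" "r \<in> X" "s \<in> X" using p r s P R by auto
    show ?thesis
    proof (cases "l p = l r")
      case True
      \<comment> \<open>The exact neighbor \<open>p\<close> is the witness here: the slack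
        \<open>\<epsilon> * d q p\<close> is nonnegative.\<close>
      have "0 \<le> \<epsilon> * d q p" using assms(3) by simp
      then have "approx_nearest_neighbor d \<epsilon> P q p"
        using p D by (simp add: approx_nearest_neighbor_def algebra_simps)
      with True show ?thesis by blast
    next
      case False
      have "d q r \<le> d q s"
        using nn dist_nn_le[OF finR s, of d q] by (simp add: nearest_neighbor_def)
      also have "\<dots> \<le> d q p + d p s" using triangle q inX by blast
      finally have qr: "d q r \<le> d q p + d p s" .
      have "d p s < dist_ne d l p P / (1 + 2 / \<epsilon>)" using sel[OF p] t by simp
      moreover have "0 < 1 + 2 / \<epsilon>" using assms(3) by (simp add: add_pos_pos)
      ultimately have "d p s * (1 + 2 / \<epsilon>) < dist_ne d l p P"
        by (simp only: pos_less_divide_eq)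
      \<comment> \<open>\<open>r\<close> is a point of \<open>P\<close> outside the class of
        \<open>p\<close>, hence a candidate in the minimum \<open>dist_ne\<close>.\<close>
      also have "\<dots> \<le> d p r"
        using P r R False by (intro dist_ne_le) auto
      also have "\<dots> \<le> d q p + d q r"
        using triangle[of p q r] q inX by (simp add: commute)
      also have "\<dots> \<le> 2 * d q p + d p s" using qr by simp
      \<comment> \<open>One \<open>d p s\<close> cancels, leaving
        \<open>d p s * (2 / \<epsilon>) < 2 * d q p\<close>; the choice of
        \<open>2 / \<epsilon>\<close> makes the factors 2 cancel too.\<close>
      finally have "d p s < \<epsilon> * d q p"
        using assms(3) by (simp add: field_simps)
      then have "d q r \<le> (1 + \<epsilon>) * dist_nn d q P"
        using qr D by (simp add: algebra_simps)
      then show ?thesis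
        using r R by (auto simp: approx_nearest_neighbor_def)
    qed
  qed
  with R show ?thesis by (auto simp: nn_coreset_def)
qed

end
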